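(* Let $$z^\ast=\max_{S\in\Omega}\Big\{\pi(S)\sum_{l\in S}\rho_l(S)r_l\Big\},\qquad \bar z=\max_{S\in\Omega,\ (\boldsymbol\alpha,\boldsymbol\beta)\in A(S)}\Big\{h\Big(-\sum_{k=1}^{\bar u}\alpha_k-\sum_{i\in\bar S}\beta_i\Big)\sum_{l\in S}\rho_l(S)r_l\Big\}.$$ Then $z^\ast\le\bar z$.
   Context: Products are $1,\dots,n$, with revenues $r_i\ge0$ and weights $\nu_i>0$; $\rho_i(S)=\nu_i/(1+\sum_{j\in S}\nu_j)$ for $i\in S$. For $S\subseteq\{1,\dots,n\}$, $\bar S=\{1,\dots,n\}\setminus S$. The integer $\bar u\ge1$ is the number of top-priority products; $p_i^0\ge 0$ and $\eta_{ik}\ge 0$ are parameters with $\eta_{i1}=1$ and $0\le\eta_{ik}p_i^0<1$ for all $i\in\{1,\dots,n\}$, $k\in\{1,\dots,\bar u\}$. The feasible set is $\Omega=\{S\subseteq\{1,\dots,n\}:|S|\le\bar c\}$ with $\bar u<n-\bar c$ (so $\bar u$ is less than the number of products outside any feasible assortment). $\pi(S)=\min_{y\in Y(S)}\prod_{k=1}^{\bar u}\big(1-\sum_{i\in\bar S}\eta_{ik}p_i^0y_{ik}\big)$, where $Y(S)$ is the set of $y\in\{0,1\}^{\bar S\times\{1,\dots,\bar u\}}$ with $\sum_{i\in\bar S}y_{ik}=1$ for every $k$ and $\sum_{k=1}^{\bar u}y_{ik}\le1$ for every $i\in\bar S$. $A(S)$ is the set of pairs $(\boldsymbol\alpha,\boldsymbol\beta)\in\mathbb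 R_+^{\bar u}\times\mathbb R_+^{\bar S}$ with $\alpha_k+\beta_i\ge-\ln(1-\eta_{ik}p_i^0)$ for all $i\in\bar S$, $k\in\{1,\dots,\bar u\}$. Let $\theta(S)=\ln\pi(S)$, $\phi(t)=e^t$, $\theta_{\min}=\theta(\emptyset)$ and $\theta_{\max}=0$, where $\theta_{\min}<\theta_{\max}$ is assumed. The function $h:\mathbb R\to\mathbb R$ is the affine function through $(\theta_{\min},e^{\theta_{\min}})$ and $(\theta_{\max},e^{\theta_{\max}})$: $$h(t)=\frac{\phi(\theta_{\max})-\phi(\theta_{\min})}{\theta_{\max}-\theta_{\min}}(t-\theta_{\min})+\phi(\theta_{\min}).$$ *)

theory Defs
  imports Complex_Main "HOL-Library.FuncSet"
begin

text \<open>Vectors indexed by a finite set \<open>I\<close> are extensional functions on \<open>I\<close> (\<open>PiE\<close>).\<close>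

definition outside :: "nat \<Rightarrow> nat set \<Rightarrow> nat set" where
  "outside n S = {1..n} - S"

definition rho :: "(nat \<Rightarrow> real) \<Rightarrow> nat set \<Rightarrow> nat \<Rightarrow> real" where
  "rho \<nu> S i = \<nu> i / (1 + (\<Sum>j\<in>S. \<nu> j))"

definition revenue :: "(nat \<Rightarrow> real) \<Rightarrow> (nat \<Rightarrow> real) \<Rightarrow> nat set \<Rightarrow> real" where
  "revenue r \<nu> S = (\<Sum>l\<in>S. rho \<nu> S l * r l)"

definition Omega :: "nat \<Rightarrow> nat \<Rightarrow> nat set set" where
  "Omega n c = {S. S \<subseteq> {1..n} \<and> card S \<le> c}"

definition Yset :: "nat \<Rightarrow> nat \<Rightarrow> nat set \<Rightarrow> (nat \<times> nat \<Rightarrow> real) set" where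
  "Yset n u S = {y \<in> (outside n S \<times> {1..u}) \<rightarrow>\<^sub>E {0, 1}.
     (\<forall>k\<in>{1..u}. (\<Sum>i\<in>outside n S. y (i, k)) = 1) \<and>
     (\<forall>i\<in>outside n S. (\<Sum>k=1..u. y (i, k)) \<le> 1)}"

text \<open>\<open>Yset n u S\<close> is finite, and it is nonempty as soon as \<open>u \<le> card (outside n S)\<close>, so
  that \<open>Min\<close> below is a genuine minimum.\<close>

definition survival ::
  "nat \<Rightarrow> nat \<Rightarrow> (nat \<Rightarrow> real) \<Rightarrow> (nat \<Rightarrow> nat \<Rightarrow> real) \<Rightarrow> nat set \<Rightarrow> real" where
  "survival n u p \<eta> S =
     Min ((\<lambda>y. \<Prod>k=1..u. 1 - (\<Sum>i\<in>outside n S. \<eta> i k * p i * y (i, k))) ` Yset n u S)"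

definition Aset ::
  "nat \<Rightarrow> nat \<Rightarrow> (nat \<Rightarrow> real) \<Rightarrow> (nat \<Rightarrow> nat \<Rightarrow> real) \<Rightarrow> nat set
    \<Rightarrow> ((nat \<Rightarrow> real) \<times> (nat \<Rightarrow> real)) set" where
  "Aset n u p \<eta> S =
     {(\<alpha>, \<beta>). \<alpha> \<in> {1..u} \<rightarrow>\<^sub>E {0..} \<and> \<beta> \<in> outside n S \<rightarrow>\<^sub>E {0..} \<and>
        (\<forall>i\<in>outside n S. \<forall>k\<in>{1..u}. \<alpha> k + \<beta> i \<ge> - ln (1 - \<eta> i k * p i))}"

definition theta ::
  "nat \<Rightarrow> nat \<Rightarrow> (nat \<Rightarrow> real) \<Rightarrow> (nat \<Rightarrow> nat \<Rightarrow> real) \<Rightarrow> nat set \<Rightarrow> real" where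
  "theta n u p \<eta> S = ln (survival n u p \<eta> S)"

definition theta_min ::
  "nat \<Rightarrow> nat \<Rightarrow> (nat \<Rightarrow> real) \<Rightarrow> (nat \<Rightarrow> nat \<Rightarrow> real) \<Rightarrow> real" where
  "theta_min n u p \<eta> = theta n u p \<eta> {}"

definition theta_max :: real where
  "theta_max = 0"

definition h_fun ::
  "nat \<Rightarrow> nat \<Rightarrow> (nat \<Rightarrow> real) \<Rightarrow> (nat \<Rightarrow> nat \<Rightarrow> real) \<Rightarrow> real \<Rightarrow> real" where
  "h_fun n u p \<eta> t =
     (exp theta_max - exp (theta_min n u p \<eta>)) / (theta_max - theta_min n u p \<eta>)
       * (t - theta_min n u p \<eta>) + exp (theta_min n u p \<eta>)"

definition is_maximum :: "real set \<Rightarrow> real \<Rightarrow> bool" where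
  "is_maximum V z \<longleftrightarrow> z \<in> V \<and> (\<forall>v\<in>V. v \<le> z)"

definition z_star_values ::
  "nat \<Rightarrow> nat \<Rightarrow> nat \<Rightarrow> (nat \<Rightarrow> real) \<Rightarrow> (nat \<Rightarrow> real) \<Rightarrow> (nat \<Rightarrow> real) \<Rightarrow> (nat \<Rightarrow> nat \<Rightarrow> real)
    \<Rightarrow> real set" where
  "z_star_values n c u r \<nu> p \<eta> = {survival n u p \<eta> S * revenue r \<nu> S | S. S \<in> Omega n c}"

definition z_bar_values ::
  "nat \<Rightarrow> nat \<Rightarrow> nat \<Rightarrow> (nat \<Rightarrow> real) \<Rightarrow> (nat \<Rightarrow> real) \<Rightarrow> (nat \<Rightarrow> real) \<Rightarrow> (nat \<Rightarrow> nat \<Rightarrow> real)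
    \<Rightarrow> real set" where
  "z_bar_values n c u r \<nu> p \<eta> =
     {h_fun n u p \<eta> (- (\<Sum>k=1..u. \<alpha> k) - (\<Sum>i\<in>outside n S. \<beta> i)) * revenue r \<nu> S
      | S \<alpha> \<beta>. S \<in> Omega n c \<and> (\<alpha>, \<beta>) \<in> Aset n u p \<eta> S}"

text \<open>\<open>z_bar_values\<close> is in general infinite, so \<open>Max\<close> would be meaningless on it; \<open>Greatest\<close> is
  determined exactly when the maximum is attained.\<close>

definition z_star ::
  "nat \<Rightarrow> nat \<Rightarrow> nat \<Rightarrow> (nat \<Rightarrow> real) \<Rightarrow> (nat \<Rightarrow> real) \<Rightarrow> (nat \<Rightarrow> real) \<Rightarrow> (nat \<Rightarrow> nat \<Rightarrow> real)
    \<Rightarrow> real" where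
  "z_star n c u r \<nu> p \<eta> = (GREATEST z. z \<in> z_star_values n c u r \<nu> p \<eta>)"

definition z_bar ::
  "nat \<Rightarrow> nat \<Rightarrow> nat \<Rightarrow> (nat \<Rightarrow> real) \<Rightarrow> (nat \<Rightarrow> real) \<Rightarrow> (nat \<Rightarrow> real) \<Rightarrow> (nat \<Rightarrow> nat \<Rightarrow> real)
    \<Rightarrow> real" where
  "z_bar n c u r \<nu> p \<eta> = (GREATEST z. z \<in> z_bar_values n c u r \<nu> p \<eta>)"

end

theory Submission
  imports Defs "HOL-Analysis.Convex" "HOL-Combinatorics.Cycles"
begin

text \<open>
  Taking logarithms turns the survival probability of an assortment \<open>S\<close> into an assignment
  problem: \<open>- theta n u p \<eta> S\<close> is the largest total weight, with weights
  \<open>w i k = - ln (1 - \<eta> i k * p i) \<ge> 0\<close>, of an injective choice of one outside product for each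
  priority level. The set \<open>Aset n u p \<eta> S\<close> is the feasible set of the dual linear program, so the
  real content is strong duality with attainment on both sides (Egervary's theorem): the largest
  value of \<open>- (\<Sum>k. \<alpha> k) - (\<Sum>i. \<beta> i)\<close> over \<open>Aset n u p \<eta> S\<close> exists and is exactly
  \<open>theta n u p \<eta> S\<close> (\<open>dual_value_le_theta\<close>, \<open>dual_value_attains_theta\<close>).

  Given this, the chord \<open>h\<close> is increasing and revenues are nonnegative, so for each assortment the
  best dual choice yields the value \<open>h (theta S) * revenue S\<close>, and both maxima are maxima over the
  finitely many feasible assortments. Since every product outside \<open>S\<close> is also outside the empty
  assortment, \<open>theta_min \<le> theta S \<le> theta_max\<close>; on this interval the convex function \<open>exp\<close> lies
  below its chord \<open>h\<close>. So the relaxed value dominates the true one assortment by assortment.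

  Strong duality is obtained from potentials rather than from linear programming. In an
  optimal square assignment no permutation of the columns improves the total weight, so the
  directed graph of the exchange costs has no negative closed walk
  (\<open>closed_walk_cost_nonneg\<close>). The cheapest walk to a fixed root is therefore bounded
  below, and its infimum is a potential (\<open>potential_exists\<close>); potentials of the exchange graph
  are exactly dual solutions tight on the assignment (\<open>square_assignment_duality\<close>). The
  rectangular case with nonnegative multipliers follows by padding with columns of weight zero
  (\<open>assignment_duality\<close>).
\<close>

section \<open>Potentials from cyclic monotonicity\<close>

fun walk_cost :: "('a \<Rightarrow> 'a \<Rightarrow> real) \<Rightarrow> 'a list \<Rightarrow> real" where
  "walk_cost c (x # y # zs) = c x y + walk_cost c (y # zs)"
| "walk_cost c _ = 0"

lemma walk_cost_append:
  "walk_cost c (xs @ y # ys) = walk_cost c (xs @ [y]) + walk_cost c (y # ys)"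
proof (induction xs)
  case (Cons x xs)
  then show ?case by (cases xs) simp_all
qed simp

lemma walk_cost_closed:
  "walk_cost c (x # xs @ [z]) = sum_list (map2 c (x # xs) (xs @ [z]))"
  by (induction xs arbitrary: x) simp_all

text \<open>A closed walk visiting a vertex twice splits there into two shorter closed walks, so only
  walks with distinct vertices matter. Such a walk is the cycle of a permutation of \<open>A\<close> that fixes
  all other points, and fixed points cost nothing.\<close>

lemma closed_walk_cost_nonneg:
  fixes c :: "'a \<Rightarrow> 'a \<Rightarrow> real"
  assumes fin: "finite A"
    and diag: "\<And>x. x \<in> A \<Longrightarrow> c x x = 0"
    and perm: "\<And>s. s permutes A \<Longrightarrow> 0 \<le> (\<Sum>x\<in>A. c x (s x))"
    and sub: "set (x # xs) \<subseteq> A"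
  shows "0 \<le> walk_cost c (x # xs @ [x])"
  using sub
proof (induction "length xs" arbitrary: x xs rule: less_induct)
  case less
  show ?case
  proof (cases "distinct (x # xs)")
    case True
    define s where "s = cycle_of_list (x # xs)"
    have s_perm: "s permutes A"
      unfolding s_def using cycle_permutes less.prems by (rule permutes_subset)
    have "map s (x # xs) = xs @ [x]"
      using cyclic_rotation[OF True, of 1] by (simp add: s_def)
    then have "walk_cost c (x # xs @ [x]) = sum_list (map2 c (x # xs) (map s (x # xs)))"
      by (simp only: walk_cost_closed)
    also have "map2 c (x # xs) (map s (x # xs)) = map (\<lambda>y. c y (s y)) (x # xs)"
      by (rule nth_equalityI) (simp_all del: list.map)
    also have "sum_list \<dots> = (\<Sum>y\<in>set (x # xs). c y (s y))"
      using True by (rule sum_list_distinct_conv_sum_set)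
    also have "\<dots> = (\<Sum>y\<in>A. c y (s y))"
    proof (rule sum.mono_neutral_left[OF fin less.prems], rule ballI)
      fix y assume y: "y \<in> A - set (x # xs)"
      then have "s y = y"
        unfolding s_def by (intro id_outside_supp) blast
      with y show "c y (s y) = 0"
        using diag by simp
    qed
    finally show ?thesis
      using perm[OF s_perm] by simp
  next
    case False
    then obtain as bs cs y where dec: "x # xs = as @ [y] @ bs @ [y] @ cs"
      using not_distinct_decomp by blast
    have y_bs: "set (y # bs) \<subseteq> A"
      using less.prems unfolding dec by auto
    have len: "Suc (length xs) = length as + length bs + length cs + 2"
      using arg_cong[OF dec, of length] by simp
    have "0 \<le> walk_cost c (y # bs @ [y])"
      using less.hyps[of bs y] len y_bs by simp
    moreover have "0 \<le> walk_cost c (as @ y # cs @ [x])"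
    proof (cases as)
      case Nil
      then have "y = x" using dec by simp
      then show ?thesis
        using less.hyps[of cs x] len less.prems unfolding dec by (auto simp: Nil)
    next
      case (Cons a as')
      then have "a = x" using dec by simp
      then show ?thesis
        using less.hyps[of "as' @ y # cs" x] len less.prems unfolding dec by (auto simp: Cons)
    qed
    moreover have "walk_cost c (x # xs @ [x])
        = walk_cost c (as @ y # cs @ [x]) + walk_cost c (y # bs @ [y])"
    proof -
      have eq: "x # xs @ [x] = as @ y # (bs @ y # (cs @ [x]))"
        using dec by (metis append.assoc append_Cons append_Nil)
      show ?thesis
        unfolding eq
        using walk_cost_append[of c as y "bs @ y # (cs @ [x])"]
          walk_cost_append[of c "y # bs" y "cs @ [x]"]
          walk_cost_append[of c as y "cs @ [x]"]
        by simp
    qed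
    ultimately show ?thesis by simp
  qed
qed

text \<open>The potential of \<open>x\<close> is the infimal cost of a walk from \<open>x\<close> to a fixed root \<open>r\<close>. Prefixing a
  walk from \<open>y\<close> with the step from \<open>x\<close> to \<open>y\<close> gives the inequality. The infimum is finite because
  closing up a walk by a step from \<open>r\<close> to \<open>x\<close> gives a closed walk, whose cost is nonnegative.\<close>

lemma potential_exists:
  fixes c :: "'a \<Rightarrow> 'a \<Rightarrow> real"
  assumes fin: "finite A"
    and diag: "\<And>x. x \<in> A \<Longrightarrow> c x x = 0"
    and perm: "\<And>s. s permutes A \<Longrightarrow> 0 \<le> (\<Sum>x\<in>A. c x (s x))"
  obtains a :: "'a \<Rightarrow> real" where "\<And>x y. x \<in> A \<Longrightarrow> y \<in> A \<Longrightarrow> a x - a y \<le> c x y"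
proof (cases "A = {}")
  case True
  then show ?thesis using that by blast
next
  case False
  then obtain r where r: "r \<in> A" by blast
  define a where "a x = (INF xs\<in>lists A. walk_cost c (x # xs @ [r]))" for x
  have bdd: "bdd_below ((\<lambda>xs. walk_cost c (x # xs @ [r])) ` lists A)" if x: "x \<in> A" for x
  proof (rule bdd_belowI2)
    fix xs assume "xs \<in> lists A"
    then have "set (r # x # xs) \<subseteq> A"
      using x r by auto
    then have "0 \<le> walk_cost c (r # (x # xs) @ [r])"
      using closed_walk_cost_nonneg[of A c r "x # xs"] fin diag perm by blast
    then show "- c r x \<le> walk_cost c (x # xs @ [r])" by simp
  qed
  show ?thesis
  proof (rule that)
    fix x y assume x: "x \<in> A" and y: "y \<in> A"
    have "a x - c x y \<le> a y"
      unfolding a_def[of y]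
    proof (rule cINF_greatest)
      fix xs assume xs: "xs \<in> lists A"
      have "a x \<le> walk_cost c (x # (y # xs) @ [r])"
        unfolding a_def using xs y by (intro cINF_lower bdd x) auto
      then show "a x - c x y \<le> walk_cost c (y # xs @ [r])" by simp
    qed auto
    then show "a x - a y \<le> c x y" by simp
  qed
qed

section \<open>Duality for the assignment problem\<close>

text \<open>Let \<open>g\<close> be a bijection of largest total weight and let \<open>c k l\<close> be the loss when the row
  assigned to column \<open>k\<close> moves to column \<open>l\<close>. Optimality of \<open>g\<close> is the permutation hypothesis of
  \<open>potential_exists\<close>. Using the potential as column multipliers \<open>a\<close>, tightness along \<open>g\<close> dictates
  the row multipliers \<open>b\<close>, and the inequality for the potential becomes dual feasibility.\<close>

lemma square_assignment_duality:
  fixes w :: "'i \<Rightarrow> 'k \<Rightarrow> real"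
  assumes fin: "finite I" "finite K" and card: "card K = card I"
  obtains g a b where "bij_betw g K I"
    and "\<And>i k. i \<in> I \<Longrightarrow> k \<in> K \<Longrightarrow> w i k \<le> a k + b i"
    and "(\<Sum>k\<in>K. a k) + (\<Sum>i\<in>I. b i) = (\<Sum>k\<in>K. w (g k) k)"
proof -
  define B where "B = {g \<in> K \<rightarrow>\<^sub>E I. bij_betw g K I}"
  define val where "val g = (\<Sum>k\<in>K. w (g k) k)" for g
  have finB: "finite B"
    unfolding B_def by (rule finite_subset[OF _ finite_PiE[of K "\<lambda>_. I"]]) (auto simp: fin)
  have restrict_B: "restrict g K \<in> B" if "bij_betw g K I" for g
    using that bij_betw_cong[of K "restrict g K" g I]
    by (auto simp: B_def dest: bij_betw_apply)
  have "B \<noteq> {}"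
    using finite_same_card_bij[OF fin(2,1) card] restrict_B by blast
  then have max_mem: "Max (val ` B) \<in> val ` B"
    by (intro Max_in) (simp_all add: finB)
  then obtain g where gB: "g \<in> B" and g_max: "val g = Max (val ` B)" by auto
  have g: "bij_betw g K I" using gB by (simp add: B_def)
  have best: "val h \<le> val g" if h: "bij_betw h K I" for h
  proof -
    have "val (restrict h K) \<le> val g"
      unfolding g_max using restrict_B[OF h] finB by simp
    then show ?thesis by (simp add: val_def)
  qed
  define c where "c k l = w (g k) k - w (g k) l" for k l
  have "0 \<le> (\<Sum>k\<in>K. c k (s k))" if s: "s permutes K" for s
  proof -
    \<comment> \<open>Moving row \<open>g k\<close> to column \<open>s k\<close> for every \<open>k\<close> is the assignment \<open>g \<circ> inv s\<close>.\<close>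
    have "(\<Sum>k\<in>K. w (g k) (s k)) = (\<Sum>k\<in>K. w (g (inv s (s k))) (s k))"
      using s by (simp add: permutes_inverses)
    also have "\<dots> = val (g \<circ> inv s)"
      unfolding val_def
      using sum.permute[OF s, of "\<lambda>k. w ((g \<circ> inv s) k) k"] by (simp add: comp_def)
    also have "\<dots> \<le> val g"
      by (intro best bij_betw_trans[OF permutes_imp_bij[OF permutes_inv[OF s]] g])
    finally show ?thesis
      by (simp add: c_def val_def sum_subtractf)
  qed
  then obtain a where a: "\<And>k l. k \<in> K \<Longrightarrow> l \<in> K \<Longrightarrow> a k - a l \<le> c k l"
    using potential_exists[OF fin(2), of c] by (auto simp: c_def)
  define q where "q = inv_into K g"
  have q: "q i \<in> K" "g (q i) = i" if "i \<in> I" for i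
    using that g bij_betw_inv_into[OF g]
    by (auto simp: q_def bij_betw_inv_into_right dest: bij_betw_apply)
  have qg: "q (g k) = k" if "k \<in> K" for k
    using that g by (simp add: q_def bij_betw_inv_into_left)
  define b where "b i = w i (q i) - a (q i)" for i
  show ?thesis
  proof (rule that[OF g])
    show "w i k \<le> a k + b i" if "i \<in> I" "k \<in> K" for i k
      using a[of "q i" k] q[of i] that by (simp add: b_def c_def)
    have "(\<Sum>i\<in>I. b i) = (\<Sum>k\<in>K. b (g k))"
      using sum.reindex_bij_betw[OF g, of b] by simp
    then show "(\<Sum>k\<in>K. a k) + (\<Sum>i\<in>I. b i) = (\<Sum>k\<in>K. w (g k) k)"
      by (simp add: b_def qg sum_subtractf)
  qed
qed

text \<open>Columns \<open>u + 1, \<dots>, card I\<close> of weight zero make the problem square. Moving a constant from the row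
  to the column multipliers changes neither feasibility nor the total in the square problem, so the
  least \<open>\<beta> i\<close> may be taken to be \<open>0\<close>; feasibility in that row and nonnegativity of the weights then
  force all \<open>\<alpha> k\<close> to be nonnegative. Discarding the nonnegative multipliers of the added columns can
  only lower the total, whence an inequality in the conclusion; the reverse inequality is
  weak duality.\<close>

lemma assignment_duality:
  fixes w :: "'i \<Rightarrow> nat \<Rightarrow> real"
  assumes fin: "finite I" and ne: "I \<noteq> {}" and le: "u \<le> card I"
    and nonneg: "\<And>i k. i \<in> I \<Longrightarrow> k \<in> {1..u} \<Longrightarrow> 0 \<le> w i k"
  obtains g \<alpha> \<beta> where "g \<in> {1..u} \<rightarrow> I" "inj_on g {1..u}"
    and "\<And>k. k \<in> {1..u} \<Longrightarrow> 0 \<le> \<alpha> k" "\<And>i. i \<in> I \<Longrightarrow> 0 \<le> \<beta> i"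
    and "\<And>i k. i \<in> I \<Longrightarrow> k \<in> {1..u} \<Longrightarrow> w i k \<le> \<alpha> k + \<beta> i"
    and "(\<Sum>k=1..u. \<alpha> k) + (\<Sum>i\<in>I. \<beta> i) \<le> (\<Sum>k=1..u. w (g k) k)"
proof -
  define K where "K = {1..card I}"
  have sub: "{1..u} \<subseteq> K" using le by (auto simp: K_def)
  define w' where "w' i k = (if k \<in> {1..u} then w i k else 0)" for i k
  have w'_nonneg: "0 \<le> w' i k" if "i \<in> I" for i k
    using nonneg[OF that] by (simp add: w'_def)
  have finK: "finite K" and cardK: "card K = card I" by (simp_all add: K_def)
  obtain g a b where g: "bij_betw g K I"
    and feas: "\<And>i k. i \<in> I \<Longrightarrow> k \<in> K \<Longrightarrow> w' i k \<le> a k + b i"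
    and tight: "(\<Sum>k\<in>K. a k) + (\<Sum>i\<in>I. b i) = (\<Sum>k\<in>K. w' (g k) k)"
    using square_assignment_duality[OF fin finK cardK, of w'] by blast
  define m where "m = Min (b ` I)"
  define \<alpha> where "\<alpha> k = a k + m" for k
  define \<beta> where "\<beta> i = b i - m" for i
  have "m \<in> b ` I"
    unfolding m_def using fin ne by (intro Min_in) auto
  then obtain j where j: "j \<in> I" "b j = m" by auto
  have \<alpha>_nonneg: "0 \<le> \<alpha> k" if "k \<in> K" for k
    using feas[OF j(1) that] w'_nonneg[OF j(1), of k] j(2) by (simp add: \<alpha>_def)
  have \<beta>_nonneg: "0 \<le> \<beta> i" if "i \<in> I" for i
    using that fin by (simp add: \<beta>_def m_def)
  have "(\<Sum>k=1..u. \<alpha> k) \<le> (\<Sum>k\<in>K. \<alpha> k)"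
    using sub \<alpha>_nonneg finK by (intro sum_mono2) auto
  moreover have "(\<Sum>k\<in>K. \<alpha> k) + (\<Sum>i\<in>I. \<beta> i) = (\<Sum>k\<in>K. w' (g k) k)"
    using tight by (simp add: \<alpha>_def \<beta>_def sum.distrib sum_subtractf cardK)
  moreover have "(\<Sum>k\<in>K. w' (g k) k) = (\<Sum>k=1..u. w (g k) k)"
  proof -
    have "(\<Sum>k=1..u. w (g k) k) = (\<Sum>k=1..u. w' (g k) k)"
      by (simp add: w'_def)
    also have "\<dots> = (\<Sum>k\<in>K. w' (g k) k)"
      by (rule sum.mono_neutral_left[OF finK sub]) (auto simp: w'_def)
    finally show ?thesis by simp
  qed
  ultimately have "(\<Sum>k=1..u. \<alpha> k) + (\<Sum>i\<in>I. \<beta> i) \<le> (\<Sum>k=1..u. w (g k) k)"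
    by simp
  moreover have "w i k \<le> \<alpha> k + \<beta> i" if "i \<in> I" "k \<in> {1..u}" for i k
    using feas[of i k] that sub by (auto simp: w'_def \<alpha>_def \<beta>_def)
  moreover have "g \<in> {1..u} \<rightarrow> I" "inj_on g {1..u}"
    using g sub by (auto simp: bij_betw_def intro: inj_on_subset)
  ultimately show ?thesis
    using that[of g \<alpha> \<beta>] \<alpha>_nonneg \<beta>_nonneg sub by blast
qed

section \<open>The survival probability as an optimal assignment\<close>

text \<open>The 0-1 matrices of \<open>Yset\<close> are the indicators of injections from priority levels to outside
  products. Extensionality keeps this set of injections finite.\<close>

definition placements :: "nat \<Rightarrow> nat \<Rightarrow> nat set \<Rightarrow> (nat \<Rightarrow> nat) set" where
  "placements n u S = {g \<in> {1..u} \<rightarrow>\<^sub>E outside n S. inj_on g {1..u}}"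

definition placement_survival ::
  "nat \<Rightarrow> (nat \<Rightarrow> real) \<Rightarrow> (nat \<Rightarrow> nat \<Rightarrow> real) \<Rightarrow> (nat \<Rightarrow> nat) \<Rightarrow> real" where
  "placement_survival u p \<eta> g = (\<Prod>k=1..u. 1 - \<eta> (g k) k * p (g k))"

lemma finite_outside: "finite (outside n S)"
  by (simp add: outside_def)

lemma finite_placements: "finite (placements n u S)"
  unfolding placements_def
  by (rule finite_subset[OF _ finite_PiE[of "{1..u}" "\<lambda>_. outside n S"]])
    (auto simp: finite_outside)

lemma placements_nonempty:
  assumes "u \<le> card (outside n S)"
  shows "placements n u S \<noteq> {}"
proof -
  obtain g where g: "g ` {1..u} \<subseteq> outside n S" "inj_on g {1..u}"
    using card_le_inj[of "{1..u}" "outside n S"] assms finite_outside by auto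
  then have "restrict g {1..u} \<in> placements n u S"
    by (auto simp: placements_def inj_on_restrict_eq)
  then show ?thesis by blast
qed

lemma placement_survival_indicator:
  assumes "g \<in> {1..u} \<rightarrow> outside n S"
    and "\<And>i k. i \<in> outside n S \<Longrightarrow> k \<in> {1..u} \<Longrightarrow> y (i, k) = (if i = g k then 1 else 0)"
  shows "(\<Prod>k=1..u. 1 - (\<Sum>i\<in>outside n S. \<eta> i k * p i * y (i, k))) = placement_survival u p \<eta> g"
  unfolding placement_survival_def
proof (rule prod.cong[OF refl])
  fix k assume k: "k \<in> {1..u}"
  have "(\<Sum>i\<in>outside n S. \<eta> i k * p i * y (i, k))
      = (\<Sum>i\<in>outside n S. if i = g k then \<eta> i k * p i else 0)"
    using assms(2)[OF _ k] by (intro sum.cong) auto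
  also have "\<dots> = \<eta> (g k) k * p (g k)"
    using assms(1) k by (auto simp: finite_outside)
  finally show "1 - (\<Sum>i\<in>outside n S. \<eta> i k * p i * y (i, k)) = 1 - \<eta> (g k) k * p (g k)"
    by simp
qed

lemma Yset_imp_placement:
  assumes y: "y \<in> Yset n u S"
  obtains g where "g \<in> placements n u S"
    and "\<And>i k. i \<in> outside n S \<Longrightarrow> k \<in> {1..u} \<Longrightarrow> y (i, k) = (if i = g k then 1 else 0)"
proof -
  have y01: "y (i, k) = 0 \<or> y (i, k) = 1" if "i \<in> outside n S" "k \<in> {1..u}" for i k
    using y that by (auto simp: Yset_def PiE_iff)
  have "\<exists>i0\<in>outside n S. \<forall>i\<in>outside n S. y (i, k) = (if i = i0 then 1 else 0)"
    if k: "k \<in> {1..u}" for k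
  proof -
    \<comment> \<open>A 0-1 column with sum one has exactly one entry equal to one.\<close>
    have "(\<Sum>i\<in>outside n S. y (i, k)) = (\<Sum>i\<in>outside n S. if y (i, k) = 1 then 1 else 0)"
      using y01[OF _ k] by (intro sum.cong) auto
    also have "\<dots> = real (card {i \<in> outside n S. y (i, k) = 1})"
      by (simp add: finite_outside flip: sum.inter_filter)
    finally have "card {i \<in> outside n S. y (i, k) = 1} = 1"
      using y k by (simp add: Yset_def)
    then obtain i0 where "{i \<in> outside n S. y (i, k) = 1} = {i0}"
      by (auto simp: card_1_singleton_iff)
    then show ?thesis
      using y01[OF _ k] by (intro bexI[of _ i0]) auto
  qed
  then obtain g0 where g0: "\<And>k. k \<in> {1..u} \<Longrightarrow> g0 k \<in> outside n S"
      "\<And>i k. k \<in> {1..u} \<Longrightarrow> i \<in> outside n S \<Longrightarrow> y (i, k) = (if i = g0 k then 1 else 0)"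
    by metis
  have "inj_on g0 {1..u}"
  proof (rule inj_onI, rule ccontr)
    fix k l assume kl: "k \<in> {1..u}" "l \<in> {1..u}" "g0 k = g0 l" "k \<noteq> l"
    \<comment> \<open>A product serving two levels would have row sum at least two.\<close>
    have "(\<Sum>j\<in>{k, l}. y (g0 k, j)) \<le> (\<Sum>j=1..u. y (g0 k, j))"
      using kl g0 by (intro sum_mono2) auto
    also have "\<dots> \<le> 1"
      using y g0(1)[OF kl(1)] by (simp add: Yset_def)
    finally show False
      using kl g0 by simp
  qed
  then have "restrict g0 {1..u} \<in> placements n u S"
    using g0(1) by (auto simp: placements_def inj_on_restrict_eq)
  then show ?thesis
    using that[of "restrict g0 {1..u}"] g0(2) by simp
qed

lemma placement_imp_Yset:
  assumes g: "g \<in> placements n u S"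
  shows "restrict (\<lambda>(i, k). if i = g k then 1 else 0) (outside n S \<times> {1..u}) \<in> Yset n u S"
    (is "?y \<in> _")
proof -
  have col: "(\<Sum>i\<in>outside n S. ?y (i, k)) = 1" if "k \<in> {1..u}" for k
    using that g by (auto simp: placements_def finite_outside PiE_iff)
  have row: "(\<Sum>k=1..u. ?y (i, k)) \<le> 1" if i: "i \<in> outside n S" for i
  proof -
    have "(\<Sum>k=1..u. ?y (i, k)) = (\<Sum>k=1..u. if i = g k then 1 else 0)"
      using i by (intro sum.cong) auto
    also have "\<dots> = real (card {k \<in> {1..u}. i = g k})"
      by (simp flip: sum.inter_filter)
    also have "\<dots> \<le> 1"
    proof -
      have "card {k \<in> {1..u}. i = g k} \<le> Suc 0"
      proof (subst card_le_Suc0_iff_eq)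
        have "inj_on g {1..u}"
          using g by (simp add: placements_def)
        then show "\<forall>k\<in>{k \<in> {1..u}. i = g k}. \<forall>l\<in>{k \<in> {1..u}. i = g k}. k = l"
          unfolding inj_on_def by blast
      qed simp
      then show ?thesis by simp
    qed
    finally show ?thesis .
  qed
  show ?thesis
    unfolding Yset_def using col row by (auto simp: PiE_iff)
qed

lemma survival_eq_Min_placements:
  "survival n u p \<eta> S = Min (placement_survival u p \<eta> ` placements n u S)"
  unfolding survival_def
proof (rule arg_cong[of _ _ Min], intro equalityI subsetI; elim imageE)
  fix v y
  assume v: "v = (\<Prod>k=1..u. 1 - (\<Sum>i\<in>outside n S. \<eta> i k * p i * y (i, k)))"
    and y: "y \<in> Yset n u S"
  obtain g where g: "g \<in> placements n u S"
      "\<And>i k. i \<in> outside n S \<Longrightarrow> k \<in> {1..u} \<Longrightarrow> y (i, k) = (if i = g k then 1 else 0)"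
    using Yset_imp_placement[OF y] by metis
  have "v = placement_survival u p \<eta> g"
    unfolding v using g by (intro placement_survival_indicator) (auto simp: placements_def)
  then show "v \<in> placement_survival u p \<eta> ` placements n u S"
    using g(1) by blast
next
  fix v g
  assume v: "v = placement_survival u p \<eta> g" and g: "g \<in> placements n u S"
  define y :: "nat \<times> nat \<Rightarrow> real"
    where "y = restrict (\<lambda>(i, k). if i = g k then 1 else 0) (outside n S \<times> {1..u})"
  have "v = (\<Prod>k=1..u. 1 - (\<Sum>i\<in>outside n S. \<eta> i k * p i * y (i, k)))"
    unfolding v using g
    by (intro placement_survival_indicator[symmetric]) (auto simp: placements_def y_def)
  moreover have "y \<in> Yset n u S"
    unfolding y_def by (rule placement_imp_Yset[OF g])
  ultimately show "v \<in> (\<lambda>y. \<Prod>k=1..u. 1 - (\<Sum>i\<in>outside n S. \<eta> i k * p i * y (i, k))) ` Yset n u S"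
    by blast
qed

context
  fixes n u :: nat and p :: "nat \<Rightarrow> real" and \<eta> :: "nat \<Rightarrow> nat \<Rightarrow> real"
  assumes prob: "\<And>i k. i \<in> {1..n} \<Longrightarrow> k \<in> {1..u} \<Longrightarrow> 0 \<le> \<eta> i k * p i \<and> \<eta> i k * p i < 1"
begin

lemma placement_factor:
  assumes "g \<in> placements n u S" "k \<in> {1..u}"
  shows "0 < 1 - \<eta> (g k) k * p (g k)" "1 - \<eta> (g k) k * p (g k) \<le> 1"
proof -
  have "g k \<in> {1..n}"
    using assms by (auto simp: placements_def outside_def PiE_iff)
  then show "0 < 1 - \<eta> (g k) k * p (g k)" "1 - \<eta> (g k) k * p (g k) \<le> 1"
    using prob assms(2) by force+
qed

lemma ln_placement_survival:
  assumes "g \<in> placements n u S"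
  shows "ln (placement_survival u p \<eta> g) = - (\<Sum>k=1..u. - ln (1 - \<eta> (g k) k * p (g k)))"
  unfolding placement_survival_def
  using ln_prod[of "{1..u}" "\<lambda>k. 1 - \<eta> (g k) k * p (g k)"] placement_factor(1)[OF assms]
  by (force simp: sum_negf)

lemma placement_survival_pos:
  assumes "g \<in> placements n u S"
  shows "0 < placement_survival u p \<eta> g"
  unfolding placement_survival_def by (intro prod_pos ballI placement_factor[OF assms])

lemma survival_le_placement_survival:
  assumes "g \<in> placements n u S"
  shows "survival n u p \<eta> S \<le> placement_survival u p \<eta> g"
  unfolding survival_eq_Min_placements using assms by (intro Min_le) (auto simp: finite_placements)

context
  fixes S :: "nat set"
  assumes room: "u \<le> card (outside n S)"
begin

lemma survival_attained:
  obtains g where "g \<in> placements n u S" "survival n u p \<eta> S = placement_survival u p \<eta> g"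
proof -
  have "survival n u p \<eta> S \<in> placement_survival u p \<eta> ` placements n u S"
    unfolding survival_eq_Min_placements
    by (intro Min_in) (simp_all add: finite_placements placements_nonempty room)
  then show ?thesis using that by blast
qed

lemma survival_pos: "0 < survival n u p \<eta> S"
  using survival_attained placement_survival_pos by metis

lemma exp_theta: "exp (theta n u p \<eta> S) = survival n u p \<eta> S"
  by (simp add: theta_def survival_pos)

lemma theta_le_theta_max: "theta n u p \<eta> S \<le> theta_max"
proof -
  obtain g where g: "g \<in> placements n u S" "survival n u p \<eta> S = placement_survival u p \<eta> g"
    by (rule survival_attained)
  have "survival n u p \<eta> S \<le> 1"
    unfolding g(2) placement_survival_def
    using placement_factor[OF g(1)] by (intro prod_le_1) (auto intro: less_imp_le)
  then show ?thesis
    using survival_pos by (simp add: theta_def theta_max_def)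
qed

text \<open>Every placement outside \<open>S\<close> is a placement outside the empty assortment, so the minimum that
  defines the survival probability of the empty assortment runs over a larger set.\<close>

lemma theta_min_le_theta: "theta_min n u p \<eta> \<le> theta n u p \<eta> S"
proof -
  have sub: "outside n S \<subseteq> outside n {}"
    by (auto simp: outside_def)
  obtain g where g: "g \<in> placements n u S" "survival n u p \<eta> S = placement_survival u p \<eta> g"
    by (rule survival_attained)
  have g_empty: "g \<in> placements n u {}"
    using g(1) sub by (auto simp: placements_def PiE_iff)
  obtain g' where g': "g' \<in> placements n u {}"
      "survival n u p \<eta> {} = placement_survival u p \<eta> g'"
  proof -
    have "survival n u p \<eta> {} \<in> placement_survival u p \<eta> ` placements n u {}"
      unfolding survival_eq_Min_placements
      using g_empty by (intro Min_in) (auto simp: finite_placements)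
    then show ?thesis using that by blast
  qed
  have "survival n u p \<eta> {} \<le> survival n u p \<eta> S"
    unfolding g(2) by (rule survival_le_placement_survival[OF g_empty])
  moreover have "0 < survival n u p \<eta> {}"
    unfolding g'(2) by (rule placement_survival_pos[OF g'(1)])
  ultimately show ?thesis
    by (simp add: theta_min_def theta_def)
qed

text \<open>Weak duality: summing the dual constraints along an optimal placement \<open>g\<close> uses each \<open>\<alpha> k\<close> once
  and, by injectivity, each \<open>\<beta> i\<close> at most once; the unused \<open>\<beta> i\<close> are nonnegative.\<close>

lemma dual_value_le_theta:
  assumes dual: "(\<alpha>, \<beta>) \<in> Aset n u p \<eta> S"
  shows "- (\<Sum>k=1..u. \<alpha> k) - (\<Sum>i\<in>outside n S. \<beta> i) \<le> theta n u p \<eta> S"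
proof -
  obtain g where g: "g \<in> placements n u S" "survival n u p \<eta> S = placement_survival u p \<eta> g"
    by (rule survival_attained)
  have g_props: "\<And>k. k \<in> {1..u} \<Longrightarrow> g k \<in> outside n S" "inj_on g {1..u}"
    using g(1) by (auto simp: placements_def PiE_iff)
  have "(\<Sum>k=1..u. - ln (1 - \<eta> (g k) k * p (g k))) \<le> (\<Sum>k=1..u. \<alpha> k + \<beta> (g k))"
    using dual g_props by (intro sum_mono) (auto simp: Aset_def)
  also have "\<dots> = (\<Sum>k=1..u. \<alpha> k) + (\<Sum>i\<in>g ` {1..u}. \<beta> i)"
    using sum.reindex[OF g_props(2), of \<beta>] by (simp add: sum.distrib comp_def)
  also have "(\<Sum>i\<in>g ` {1..u}. \<beta> i) \<le> (\<Sum>i\<in>outside n S. \<beta> i)"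
    using dual g_props(1) by (intro sum_mono2) (auto simp: Aset_def PiE_iff finite_outside)
  finally show ?thesis
    using ln_placement_survival[OF g(1)] by (simp add: theta_def g(2))
qed

text \<open>Strong duality: the placement provided by \<open>assignment_duality\<close> survives with probability at
  least the minimum \<open>survival n u p \<eta> S\<close>, so the accompanying multipliers have dual value at least
  \<open>theta n u p \<eta> S\<close>, and weak duality makes this an equality.\<close>

lemma dual_value_attains_theta:
  assumes u: "1 \<le> u"
  obtains \<alpha> \<beta> where "(\<alpha>, \<beta>) \<in> Aset n u p \<eta> S"
    and "- (\<Sum>k=1..u. \<alpha> k) - (\<Sum>i\<in>outside n S. \<beta> i) = theta n u p \<eta> S"
proof -
  define w where "w i k = - ln (1 - \<eta> i k * p i)" for i k
  have w_nonneg: "0 \<le> w i k" if "i \<in> outside n S" "k \<in> {1..u}" for i k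
    using prob[of i k] that by (auto simp: w_def outside_def)
  have ne: "outside n S \<noteq> {}" using room u by auto
  obtain g a b where g: "g \<in> {1..u} \<rightarrow> outside n S" "inj_on g {1..u}"
    and a: "\<And>k. k \<in> {1..u} \<Longrightarrow> 0 \<le> a k" and b: "\<And>i. i \<in> outside n S \<Longrightarrow> 0 \<le> b i"
    and feas: "\<And>i k. i \<in> outside n S \<Longrightarrow> k \<in> {1..u} \<Longrightarrow> w i k \<le> a k + b i"
    and le: "(\<Sum>k=1..u. a k) + (\<Sum>i\<in>outside n S. b i) \<le> (\<Sum>k=1..u. w (g k) k)"
    using assignment_duality[where w = w, OF finite_outside ne room w_nonneg] by blast
  define \<alpha> where "\<alpha> = restrict a {1..u}"
  define \<beta> where "\<beta> = restrict b (outside n S)"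
  define g' where "g' = restrict g {1..u}"
  have g': "g' \<in> placements n u S"
    using g by (auto simp: g'_def placements_def inj_on_restrict_eq)
  have mem: "(\<alpha>, \<beta>) \<in> Aset n u p \<eta> S"
    using a b feas by (auto simp: Aset_def \<alpha>_def \<beta>_def w_def)
  have "theta n u p \<eta> S \<le> ln (placement_survival u p \<eta> g')"
    using survival_le_placement_survival[OF g'] survival_pos placement_survival_pos[OF g']
    by (simp add: theta_def)
  also have "\<dots> = - (\<Sum>k=1..u. w (g k) k)"
    unfolding ln_placement_survival[OF g'] by (simp add: g'_def w_def)
  also have "\<dots> \<le> - (\<Sum>k=1..u. \<alpha> k) - (\<Sum>i\<in>outside n S. \<beta> i)"
    using le by (simp add: \<alpha>_def \<beta>_def)
  finally have "theta n u p \<eta> S \<le> - (\<Sum>k=1..u. \<alpha> k) - (\<Sum>i\<in>outside n S. \<beta> i)" .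
  then show ?thesis
    using that[OF mem] dual_value_le_theta[OF mem] by simp
qed

end

end

section \<open>The chord relaxation\<close>

lemma h_fun_mono:
  assumes "theta_min n u p \<eta> < theta_max" "s \<le> t"
  shows "h_fun n u p \<eta> s \<le> h_fun n u p \<eta> t"
  unfolding h_fun_def using assms by (intro add_right_mono mult_left_mono divide_nonneg_pos) auto

lemma exp_le_h_fun:
  assumes "theta_min n u p \<eta> \<le> t" "t \<le> theta_max"
  shows "exp t \<le> h_fun n u p \<eta> t"
  unfolding h_fun_def
  using assms by (intro convex_onD_Icc' convex_on_subset[OF exp_convex]) auto

lemma is_maximum_Max:
  assumes "finite V" "V \<noteq> {}"
  shows "is_maximum V (Max V)"
  using assms by (simp add: is_maximum_def)

lemma is_maximum_Greatest:
  assumes "is_maximum V z"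
  shows "is_maximum V (GREATEST z. z \<in> V)"
  using assms Greatest_equality[of "\<lambda>z. z \<in> V" z] by (simp add: is_maximum_def)

theorem proposition3:
  fixes n c u :: nat
    and r \<nu> p :: "nat \<Rightarrow> real"
    and \<eta> :: "nat \<Rightarrow> nat \<Rightarrow> real"
  assumes "\<And>i. i \<in> {1..n} \<Longrightarrow> r i \<ge> 0"
    and "\<And>i. i \<in> {1..n} \<Longrightarrow> \<nu> i > 0"
    and "u \<ge> 1"
    and "c + u < n"
    and "\<And>i. i \<in> {1..n} \<Longrightarrow> p i \<ge> 0"
    and "\<And>i k. i \<in> {1..n} \<Longrightarrow> k \<in> {1..u} \<Longrightarrow> \<eta> i k \<ge> 0"
    and "\<And>i. i \<in> {1..n} \<Longrightarrow> \<eta> i 1 = 1"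
    and "\<And>i k. i \<in> {1..n} \<Longrightarrow> k \<in> {1..u} \<Longrightarrow> 0 \<le> \<eta> i k * p i \<and> \<eta> i k * p i < 1"
    and "theta_min n u p \<eta> < theta_max"
  shows "is_maximum (z_star_values n c u r \<nu> p \<eta>) (z_star n c u r \<nu> p \<eta>)
       \<and> is_maximum (z_bar_values n c u r \<nu> p \<eta>) (z_bar n c u r \<nu> p \<eta>)
       \<and> z_star n c u r \<nu> p \<eta> \<le> z_bar n c u r \<nu> p \<eta>"
proof -
  note r_nonneg = assms(1) and \<nu>_pos = assms(2) and u_pos = assms(3) and size = assms(4)
    and prob = assms(8) and gap = assms(9)
  let ?\<theta> = "theta n u p \<eta>" and ?h = "h_fun n u p \<eta>" and ?R = "revenue r \<nu>"
  have room: "u \<le> card (outside n S)" if "S \<in> Omega n c" for S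
  proof -
    have "finite S" "S \<subseteq> {1..n}" "card S \<le> c"
      using that finite_subset[of S "{1..n}"] by (auto simp: Omega_def)
    then show ?thesis
      using size by (simp add: outside_def card_Diff_subset)
  qed
  have R_nonneg: "0 \<le> ?R S" if "S \<in> Omega n c" for S
  proof -
    have S: "i \<in> {1..n}" if "i \<in> S" for i
      using that \<open>S \<in> Omega n c\<close> by (auto simp: Omega_def)
    have "0 \<le> (\<Sum>j\<in>S. \<nu> j)"
      using \<nu>_pos S by (intro sum_nonneg) (auto intro: less_imp_le)
    then show ?thesis
      unfolding revenue_def rho_def using S \<nu>_pos r_nonneg
      by (intro sum_nonneg mult_nonneg_nonneg divide_nonneg_nonneg) (auto intro: less_imp_le)
  qed
  have fin: "finite (Omega n c)"
    by (rule finite_subset[of _ "Pow {1..n}"]) (auto simp: Omega_def)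
  have ne: "Omega n c \<noteq> {}"
    by (auto simp: Omega_def intro!: exI[of _ "{}"])

  have "z_star_values n c u r \<nu> p \<eta> = (\<lambda>S. survival n u p \<eta> S * ?R S) ` Omega n c"
    by (auto simp: z_star_values_def)
  then have star: "is_maximum (z_star_values n c u r \<nu> p \<eta>) (z_star n c u r \<nu> p \<eta>)"
    unfolding z_star_def using fin ne
    by (intro is_maximum_Greatest[OF is_maximum_Max]) auto

  \<comment> \<open>For each assortment, an optimal dual solution gives the argument \<open>theta S\<close> to \<open>h\<close>, and no
    dual solution gives a larger one. So the infinite family of relaxed values has the same
    maximum as the finite set \<open>V\<close>.\<close>
  have dual_optimum: "?h (?\<theta> S) * ?R S \<in> z_bar_values n c u r \<nu> p \<eta>" if S: "S \<in> Omega n c" for S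
  proof -
    obtain \<alpha> \<beta> where dual: "(\<alpha>, \<beta>) \<in> Aset n u p \<eta> S"
      and dual_val: "- (\<Sum>k=1..u. \<alpha> k) - (\<Sum>i\<in>outside n S. \<beta> i) = ?\<theta> S"
      using dual_value_attains_theta[where n = n and u = u and p = p and \<eta> = \<eta>, OF prob room[OF S] u_pos] by blast
    have "?h (- (\<Sum>k=1..u. \<alpha> k) - (\<Sum>i\<in>outside n S. \<beta> i)) * ?R S
        \<in> z_bar_values n c u r \<nu> p \<eta>"
      unfolding z_bar_values_def using S dual by blast
    then show ?thesis
      unfolding dual_val .
  qed
  define V where "V = (\<lambda>S. ?h (?\<theta> S) * ?R S) ` Omega n c"
  have "is_maximum (z_bar_values n c u r \<nu> p \<eta>) (Max V)"
    unfolding is_maximum_def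
  proof (intro conjI ballI)
    have "Max V \<in> V"
      using fin ne by (intro Max_in) (auto simp: V_def)
    then show "Max V \<in> z_bar_values n c u r \<nu> p \<eta>"
      using dual_optimum by (auto simp: V_def)
    fix v assume "v \<in> z_bar_values n c u r \<nu> p \<eta>"
    then obtain S \<alpha> \<beta> where S: "S \<in> Omega n c" and dual: "(\<alpha>, \<beta>) \<in> Aset n u p \<eta> S"
      and v: "v = ?h (- (\<Sum>k=1..u. \<alpha> k) - (\<Sum>i\<in>outside n S. \<beta> i)) * ?R S"
      unfolding z_bar_values_def by blast
    have "v \<le> ?h (?\<theta> S) * ?R S"
      unfolding v
      by (intro mult_right_mono h_fun_mono[OF gap] dual_value_le_theta[where n = n and u = u and p = p and \<eta> = \<eta>, OF prob room[OF S] dual]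
          R_nonneg[OF S])
    also have "\<dots> \<le> Max V"
      using fin S by (intro Max_ge) (auto simp: V_def)
    finally show "v \<le> Max V" .
  qed
  then have bar: "is_maximum (z_bar_values n c u r \<nu> p \<eta>) (z_bar n c u r \<nu> p \<eta>)"
    unfolding z_bar_def by (rule is_maximum_Greatest)

  obtain S where S: "S \<in> Omega n c" and zS: "z_star n c u r \<nu> p \<eta> = survival n u p \<eta> S * ?R S"
    using star by (auto simp: is_maximum_def z_star_values_def)
  have "z_star n c u r \<nu> p \<eta> = exp (?\<theta> S) * ?R S"
    using exp_theta[where n = n and u = u and p = p and \<eta> = \<eta>, OF prob room[OF S]] by (simp add: zS)
  also have "\<dots> \<le> ?h (?\<theta> S) * ?R S"
    by (intro mult_right_mono exp_le_h_fun theta_min_le_theta[where n = n and u = u and p = p and \<eta> = \<eta>, OF prob room[OF S]]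
        theta_le_theta_max[where n = n and u = u and p = p and \<eta> = \<eta>, OF prob room[OF S]] R_nonneg[OF S])
  also have "\<dots> \<le> z_bar n c u r \<nu> p \<eta>"
    using bar dual_optimum[OF S] by (simp add: is_maximum_def)
  finally show ?thesis
    using star bar by blast
qed

end
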